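(* Let $(A_n)_{n\in\mathbb{N}}$ be a sequence of finite non-empty subsets of the Ulam-Harris-Neveu tree $\mathbb{T}^\infty$, and for each $n$ let $U_n$ and $V_n$ be independent and uniformly distributed on $A_n$. Assume that for all $k\in\mathbb{N}$, $$\mathbb{P}(d(U_n,V_n)\le k)=|A_n|^{-2}\sum_{u,v\in A_n}\mathbf{1}_{\{d(u,v)\le k\}}\longrightarrow 0\quad\text{as } n\to\infty .$$ Let $X=(X_u,u\in\mathbb{T}^\infty)$ be a branching Markov process indexed by $\mathbb{T}^\infty$ with values in a metric space $\mathcal{X}$, whose transition kernel $Q$ is ergodic, with unique invariant measure $\mu$. Assume that at least one of the following holds: (a) $Q$ is uniformly ergodic; (b) the sequence of random variables $(h(U_n\wedge V_n))_{n\in\mathbb{N}}$ is tight, that is, for every $\varepsilon>0$ there exists $k\in\mathbb{N}$ such that $\mathbb{P}(h(U_n\wedge V_n)>k)<\varepsilon$ for all $n$ large enough. Then, for every continuous bounded function $f:\mathcal{X}\to\mathbb{R}$, $$\bar M_{A_n}(f)=|A_n|^{-1}\sum_{u\in A_n}f(X_u)\longrightarrow \langle\mu,f\rangle\quad\text{in } L^2 \text{ as } n\to\infty .$$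
   Context: $\mathbb{T}^\infty=\bigcup_{n\in\mathbb{N}}(\mathbb{N}^* )^n$ is the Ulam-Harris-Neveu tree, with root $\partial$ the empty word; the parent $\mathrm{p}(u)$ of a non-root vertex $u$ is obtained by deleting its last letter. $h(u)$ is the height of $u$ (number of edges between $u$ and $\partial$, so $h(\partial)=0$), $u\wedge v$ is the latest common ancestor of $u$ and $v$, and $d(u,v)=h(u)+h(v)-2h(u\wedge v)$ is the graph distance. $|A|$ denotes the cardinality of $A$. A stochastic process $X=(X_u,u\in\mathbb{T}^\infty)$ with values in a metric space $\mathcal{X}$ (with its Borel $\sigma$-field) is a branching Markov process with (Markov) transition kernel $Q$ and initial distribution $\nu$ (a probability measure on $\mathcal{X}$) if for every finite subtree $T\subset\mathbb{T}^\infty$ with $\partial\in T$, $$\mathbb{P}\Bigl(\bigcap_{u\in T}\{X_u\in \mathrm{d}x_u\}\Bigr)=\nu(\mathrm{d}x_\partial)\prod_{u\in T\setminus\{\partial\}}Q(x_{\mathrm{p}(u)};\mathrm{d}x_u).$$ The initial distribution is arbitrary. $Qf(x)=\int f(y)\,Q(x;\mathrm{d}y)$ and $\langle\mu,f\rangle=\int f\,\mathrm{d}\mu$. Invariant measures are understood to be probability measures. $Q$ is ergodic (resp. uniformly ergodic) if it has a unique invariant measure $\mu$ and for every continuous bounded function $f$ on $\mathcal{X}$ we have $\lim_{n\to\infty}|Q^nf(x)-\langle\mu,f\rangle|=0$ for all $x\in\mathcal{X}$ (resp. $\lim_{n\to\infty}\sup_{x\in\mathcal{X}}|Q^nf(x)-\langle\mu,f\rangle|=0$).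 *)

theory Defs
  imports "HOL-Probability.Probability" "HOL-Library.Sublist"
begin

section \<open>The Ulam-Harris-Neveu tree\<close>

text \<open>
  Vertices are finite words over the positive integers. The root is \<open>[]\<close>, the parent of
  \<open>u \<noteq> []\<close> is \<open>butlast u\<close>, the height of \<open>u\<close> is \<open>length u\<close>, and the latest common ancestor
  of \<open>u\<close> and \<open>v\<close> is \<open>longest_common_prefix u v\<close>.
\<close>

definition UHN :: "nat list set" where
  "UHN = {u. \<forall>i\<in>set u. 0 < i}"

text \<open>The subtraction does not truncate: the common prefix is no longer than either word.\<close>

definition tree_dist :: "nat list \<Rightarrow> nat list \<Rightarrow> nat" where
  "tree_dist u v = length u + length v - 2 * length (longest_common_prefix u v)"

definition rooted_subtree :: "nat list set \<Rightarrow> bool" where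
  "rooted_subtree T \<longleftrightarrow> T \<subseteq> UHN \<and> [] \<in> T \<and> (\<forall>u\<in>T. u \<noteq> [] \<longrightarrow> butlast u \<in> T)"

text \<open>The joint law of two independent uniform points of \<open>A\<close> (for \<open>A\<close> finite and non-empty).\<close>

definition indep_unif_pair :: "'a set \<Rightarrow> ('a \<times> 'a) pmf" where
  "indep_unif_pair A = pair_pmf (pmf_of_set A) (pmf_of_set A)"

lemma prob_indep_unif_pair:
  assumes "finite A" "A \<noteq> {}"
  shows "measure_pmf.prob (indep_unif_pair A) {(u, v). P u v}
    = (\<Sum>u\<in>A. \<Sum>v\<in>A. of_bool (P u v)) / (real (card A))\<^sup>2"
proof -
  have eq: "indep_unif_pair A = pmf_of_set (A \<times> A)"
    unfolding indep_unif_pair_def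
    proof (rule pmf_eqI)
    fix p
    show "pmf (pair_pmf (pmf_of_set A) (pmf_of_set A)) p = pmf (pmf_of_set (A \<times> A)) p"
      using assms
      by (cases p) (simp add: pmf_pair pmf_of_set[OF assms(2,1)] indicator_def card_cartesian_product)
  qed
  have "(\<Sum>u\<in>A. \<Sum>v\<in>A. of_bool (P u v) :: real) = (\<Sum>p\<in>A \<times> A. of_bool (P (fst p) (snd p)))"
    by (simp add: sum.cartesian_product case_prod_unfold)
  also have "\<dots> = real (card ((A \<times> A) \<inter> {(u, v). P u v}))"
    using assms by (simp add: case_prod_unfold Int_def)
  finally show ?thesis
    using assms by (simp add: eq measure_pmf_of_set card_cartesian_product power2_eq_square)
qed


section \<open>Transition kernels and ergodicity\<close>

definition markov_kernel :: "('x::metric_space \<Rightarrow> 'x measure) \<Rightarrow> bool" where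
  "markov_kernel Q \<longleftrightarrow> Q \<in> borel \<rightarrow>\<^sub>M prob_algebra borel"

definition borel_prob :: "'x::metric_space measure \<Rightarrow> bool" where
  "borel_prob m \<longleftrightarrow> m \<in> space (prob_algebra borel)"

definition kernel_op :: "('x::metric_space \<Rightarrow> 'x measure) \<Rightarrow> ('x \<Rightarrow> real) \<Rightarrow> 'x \<Rightarrow> real" where
  "kernel_op Q f = (\<lambda>x. \<integral>y. f y \<partial>Q x)"

definition invariant_measure :: "('x::metric_space \<Rightarrow> 'x measure) \<Rightarrow> 'x measure \<Rightarrow> bool" where
  "invariant_measure Q m \<longleftrightarrow> borel_prob m \<and> m \<bind> Q = m"

definition ergodic :: "('x::metric_space \<Rightarrow> 'x measure) \<Rightarrow> bool" where
  "ergodic Q \<longleftrightarrow> (\<exists>m. invariant_measure Q m \<and> (\<forall>m'. invariant_measure Q m' \<longrightarrow> m' = m) \<and>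
     (\<forall>f. continuous_on UNIV f \<and> bounded (range f) \<longrightarrow>
       (\<forall>x. (\<lambda>n. \<bar>(kernel_op Q ^^ n) f x - (\<integral>y. f y \<partial>m)\<bar>) \<longlonglongrightarrow> 0)))"

text \<open>The real-valued supremum below is over a bounded set, since \<open>f\<close> is bounded.\<close>

definition uniformly_ergodic :: "('x::metric_space \<Rightarrow> 'x measure) \<Rightarrow> bool" where
  "uniformly_ergodic Q \<longleftrightarrow> (\<exists>m. invariant_measure Q m \<and> (\<forall>m'. invariant_measure Q m' \<longrightarrow> m' = m) \<and>
     (\<forall>f. continuous_on UNIV f \<and> bounded (range f) \<longrightarrow>
       (\<lambda>n. SUP x. \<bar>(kernel_op Q ^^ n) f x - (\<integral>y. f y \<partial>m)\<bar>) \<longlonglongrightarrow> 0))"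


section \<open>Branching Markov processes\<close>

definition parents_first :: "nat list list \<Rightarrow> bool" where
  "parents_first us \<longleftrightarrow> distinct us \<and>
     (\<forall>i<length us. us ! i \<noteq> [] \<longrightarrow> butlast (us ! i) \<in> set (take i us))"

text \<open>
  The iterated integral of \<open>F\<close> against \<open>\<nu>(dx\<^sub>\<partial>) \<Prod> Q(x\<^bsub>p(u)\<^esub>; dx\<^sub>u)\<close>, the variables
  \<open>x\<^sub>u\<close> being integrated in the order in which the vertices are listed (outermost first).
  When the list enumerates a rooted subtree with every vertex after its parent, the coordinate
  \<open>x (butlast u)\<close> is already bound when \<open>x\<^sub>u\<close> is integrated, and by Tonelli's theorem the value
  does not depend on the chosen enumeration. The last argument holds the coordinates bound so far.
\<close>

primrec tree_integral :: "'x::metric_space measure \<Rightarrow> ('x \<Rightarrow> 'x measure) \<Rightarrow> nat list list \<Rightarrow>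
    ((nat list \<Rightarrow> 'x) \<Rightarrow> ennreal) \<Rightarrow> (nat list \<Rightarrow> 'x) \<Rightarrow> ennreal" where
  "tree_integral \<nu> Q [] F x = F x"
| "tree_integral \<nu> Q (u # us) F x =
     (\<integral>\<^sup>+ y. tree_integral \<nu> Q us F (x(u := y)) \<partial>(if u = [] then \<nu> else Q (x (butlast u))))"

text \<open>
  The product formula is an identity between probability measures on \<open>PiM T (\<lambda>_. borel)\<close>,
  evaluated here on an arbitrary measurable set \<open>B\<close>. Elements of that product space take the
  value \<open>undefined\<close> outside \<open>T\<close>, hence the initial configuration \<open>\<lambda>_. undefined\<close>.
\<close>

definition branching_markov_process ::
  "'w measure \<Rightarrow> ('x::metric_space \<Rightarrow> 'x measure) \<Rightarrow> 'x measure \<Rightarrow> (nat list \<Rightarrow> 'w \<Rightarrow> 'x) \<Rightarrow> bool" where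
  "branching_markov_process M Q \<nu> X \<longleftrightarrow>
     prob_space M \<and> markov_kernel Q \<and> borel_prob \<nu> \<and>
     (\<forall>u\<in>UHN. X u \<in> borel_measurable M) \<and>
     (\<forall>T. finite T \<and> rooted_subtree T \<longrightarrow>
       (\<forall>us. set us = T \<and> parents_first us \<longrightarrow>
         (\<forall>B\<in>sets (PiM T (\<lambda>_. borel)).
           emeasure M {\<omega>\<in>space M. (\<lambda>u\<in>T. X u \<omega>) \<in> B}
             = tree_integral \<nu> Q us (indicator B) (\<lambda>_. undefined))))"

definition empirical_mean :: "nat list set \<Rightarrow> (nat list \<Rightarrow> 'w \<Rightarrow> 'x) \<Rightarrow> ('x \<Rightarrow> real) \<Rightarrow> 'w \<Rightarrow> real" where
  "empirical_mean A X f = (\<lambda>\<omega>. (\<Sum>u\<in>A. f (X u \<omega>)) / real (card A))"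

definition tendsto_L2 :: "'w measure \<Rightarrow> (nat \<Rightarrow> 'w \<Rightarrow> real) \<Rightarrow> ('w \<Rightarrow> real) \<Rightarrow> bool" where
  "tendsto_L2 M Y Z \<longleftrightarrow>
     (\<forall>n. Y n \<in> borel_measurable M \<and> integrable M (\<lambda>\<omega>. (Y n \<omega>)\<^sup>2)) \<and>
     Z \<in> borel_measurable M \<and> integrable M (\<lambda>\<omega>. (Z \<omega>)\<^sup>2) \<and>
     (\<lambda>n. \<integral>\<omega>. (Y n \<omega> - Z \<omega>)\<^sup>2 \<partial>M) \<longlonglongrightarrow> 0"

end

theory Submission
  imports Defs
begin

text \<open>
  Put \<open>g = f - \<langle>\<mu>, f\<rangle>\<close>. The second moment of the empirical mean of \<open>g\<close> is the average over pairs
  \<open>u, v \<in> A\<close> of \<open>E (g (X u) * g (X v))\<close>. With \<open>w\<close> the common ancestor of \<open>u\<close> and \<open>v\<close>, at distances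
  \<open>a\<close> and \<open>b\<close> from them, this expectation equals \<open>E (Q\<^sup>a g (X w) * Q\<^sup>b g (X w))\<close>. For most pairs
  \<open>a + b\<close> is large, so one of the two factors is small: uniformly in the state under uniform
  ergodicity, and otherwise by dominated convergence, since the law of \<open>X w\<close> depends only on the
  height of \<open>w\<close> and, by tightness, only boundedly many heights matter.
\<close>

section \<open>Iterated integrals over a subtree as integrals against a measure\<close>

text \<open>A form of \<open>parents_first\<close> suited to induction on the list: \<open>S\<close>
  holds the vertices whose coordinates are already bound, so the tail of an admissible list is again
  admissible, relative to a larger set. For \<open>S = {}\<close> the two notions agree.\<close>

primrec tree_order :: "nat list set \<Rightarrow> nat list list \<Rightarrow> bool" where
  "tree_order S [] \<longleftrightarrow> True"
| "tree_order S (u # us) \<longleftrightarrow> u \<notin> S \<and> (u \<noteq> [] \<longrightarrow> butlast u \<in> S) \<and> tree_order (insert u S) us"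

lemma tree_order_iff:
  "tree_order S us \<longleftrightarrow> distinct us \<and> set us \<inter> S = {} \<and>
     (\<forall>i<length us. us ! i \<noteq> [] \<longrightarrow> butlast (us ! i) \<in> S \<union> set (take i us))"
proof (induction us arbitrary: S)
  case (Cons u us)
  show ?case
    by (simp add: All_less_Suc2 Cons.IH) blast
qed simp

lemma parents_first_tree_order: "parents_first us \<Longrightarrow> tree_order {} us"
  by (simp add: parents_first_def tree_order_iff)

text \<open>
  The defining identity of a branching Markov process concerns sets only. Writing \<open>tree_integral\<close>
  as the integral against a measure extends it to all nonnegative measurable functions.
\<close>

lemma tree_integral_kernel:
  fixes Q :: "'x::metric_space \<Rightarrow> 'x measure"
  assumes Q: "markov_kernel Q" and \<nu>: "borel_prob \<nu>" and us: "tree_order S us"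
  shows "\<exists>K \<in> PiM S (\<lambda>_. borel) \<rightarrow>\<^sub>M subprob_algebra (PiM (S \<union> set us) (\<lambda>_. borel)).
    \<forall>x\<in>space (PiM S (\<lambda>_. borel)). \<forall>F\<in>borel_measurable (PiM (S \<union> set us) (\<lambda>_. borel)).
      tree_integral \<nu> Q us F x = (\<integral>\<^sup>+ y. F y \<partial>K x)"
  using us
proof (induction us arbitrary: S)
  case Nil
  show ?case
    by (rule bexI[of _ "return (PiM S (\<lambda>_. borel))"]) (auto simp: nn_integral_return)
next
  case (Cons u us)
  let ?P = "\<lambda>T. PiM T (\<lambda>_. borel :: 'x measure)"
  let ?R = "?P (S \<union> set (u # us))"
  \<comment> \<open>The conditional law of the new coordinate \<open>x u\<close> given the
    coordinates bound so far.\<close>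
  define L where "L = (\<lambda>x::nat list \<Rightarrow> 'x. if u = [] then \<nu> else Q (x (butlast u)))"
  have Q'[measurable]: "Q \<in> borel \<rightarrow>\<^sub>M subprob_algebra borel"
    using Q by (simp add: markov_kernel_def measurable_prob_algebraD)
  have \<nu>': "\<nu> \<in> space (subprob_algebra borel)"
    using \<nu> by (auto simp: borel_prob_def space_prob_algebra space_subprob_algebra
        prob_space_imp_subprob_space)
  \<comment> \<open>The order of the list enters here: the parent of \<open>u\<close> lies in
    \<open>S\<close>, so \<open>x (butlast u)\<close> is a measurable projection of
    \<open>x\<close>.\<close>
  have L[measurable]: "L \<in> ?P S \<rightarrow>\<^sub>M subprob_algebra borel"
  proof (cases "u = []")
    case False
    then have "butlast u \<in> S" using Cons.prems by simp
    then have [measurable]: "(\<lambda>x. x (butlast u)) \<in> ?P S \<rightarrow>\<^sub>M borel"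
      by (rule measurable_component_singleton)
    show ?thesis using False by (simp add: L_def)
  qed (simp add: L_def \<nu>')
  have ord: "tree_order (insert u S) us" using Cons.prems by simp
  obtain K where K: "K \<in> ?P (insert u S) \<rightarrow>\<^sub>M subprob_algebra (?P (insert u S \<union> set us))"
    and KF: "\<And>x F. x \<in> space (?P (insert u S)) \<Longrightarrow> F \<in> borel_measurable (?P (insert u S \<union> set us)) \<Longrightarrow>
      tree_integral \<nu> Q us F x = (\<integral>\<^sup>+ y. F y \<partial>K x)"
    using Cons.IH[OF ord] by blast
  have R: "?R = ?P (insert u S \<union> set us)" by simp
  have upd: "(\<lambda>(x, y). x(u := y)) \<in> ?P S \<Otimes>\<^sub>M borel \<rightarrow>\<^sub>M ?P (insert u S)"
    unfolding case_prod_beta by (rule measurable_fun_upd[where J = S]) auto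
  have K2: "(\<lambda>p. K ((fst p)(u := snd p))) \<in> ?P S \<Otimes>\<^sub>M borel \<rightarrow>\<^sub>M subprob_algebra ?R"
    using measurable_compose[OF upd K] by (simp add: R case_prod_beta)
  \<comment> \<open>The kernel for \<open>u # us\<close> draws \<open>x u\<close> from
    \<open>L x\<close> and then the remaining coordinates from \<open>K\<close>, started at the
    updated configuration.\<close>
  show ?case
  proof (rule bexI[of _ "\<lambda>x. L x \<bind> (\<lambda>y. K (x(u := y)))"], intro ballI)
    show "(\<lambda>x. L x \<bind> (\<lambda>y. K (x(u := y)))) \<in> ?P S \<rightarrow>\<^sub>M subprob_algebra ?R"
      by (rule measurable_bind[OF L K2])
    fix x and F :: "(nat list \<Rightarrow> 'x) \<Rightarrow> ennreal"
    assume x: "x \<in> space (?P S)" and F: "F \<in> borel_measurable ?R"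
    have Lx: "sets (L x) = sets borel"
      using measurable_space[OF L x] by (simp add: space_subprob_algebra)
    have "(\<lambda>y. K (x(u := y))) \<in> borel \<rightarrow>\<^sub>M subprob_algebra ?R"
      using measurable_compose[OF measurable_Pair1'[OF x] K2] by simp
    then have Kx: "(\<lambda>y. K (x(u := y))) \<in> L x \<rightarrow>\<^sub>M subprob_algebra ?R"
      by (simp add: measurable_cong_sets[OF Lx refl])
    have "tree_integral \<nu> Q (u # us) F x = (\<integral>\<^sup>+ y. tree_integral \<nu> Q us F (x(u := y)) \<partial>L x)"
      by (simp add: L_def)
    also have "\<dots> = (\<integral>\<^sup>+ y. \<integral>\<^sup>+ z. F z \<partial>K (x(u := y)) \<partial>L x)"
      using x F by (intro nn_integral_cong KF) (auto simp: space_PiM PiE_def extensional_def)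
    also have "\<dots> = (\<integral>\<^sup>+ z. F z \<partial>(L x \<bind> (\<lambda>y. K (x(u := y)))))"
      by (rule nn_integral_bind[OF F Kx, symmetric])
    finally show "tree_integral \<nu> Q (u # us) F x = (\<integral>\<^sup>+ z. F z \<partial>(L x \<bind> (\<lambda>y. K (x(u := y)))))" .
  qed
qed

text \<open>The last listed vertex carries the innermost integral, so a leaf listed last can be
  integrated out before all other vertices.\<close>

lemma tree_integral_snoc:
  "tree_integral \<nu> Q (us @ [u]) F x =
     tree_integral \<nu> Q us (\<lambda>x. \<integral>\<^sup>+ y. F (x(u := y)) \<partial>(if u = [] then \<nu> else Q (x (butlast u)))) x"
  by (induction us arbitrary: x) auto

section \<open>Joint law of the process on a finite subtree\<close>

locale branching_process =
  fixes M :: "'w measure" and Q :: "'x::metric_space \<Rightarrow> 'x measure" and \<nu> :: "'x measure"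
    and X :: "nat list \<Rightarrow> 'w \<Rightarrow> 'x"
  assumes branching: "branching_markov_process M Q \<nu> X"
begin

sublocale prob_space M
  using branching by (simp add: branching_markov_process_def)

lemma kernel: "markov_kernel Q"
  using branching by (simp add: branching_markov_process_def)

lemma X_measurable [measurable]: "u \<in> UHN \<Longrightarrow> X u \<in> borel_measurable M"
  using branching by (simp add: branching_markov_process_def)

text \<open>The defining identity says that the law of the restricted process and the measure from
  \<open>tree_integral_kernel\<close> agree on all measurable sets. They are therefore equal as
  measures and integrate every nonnegative measurable function alike.\<close>

lemma nn_integral_tree:
  assumes T: "finite T" "rooted_subtree T" and us: "set us = T" "parents_first us"
    and F: "F \<in> borel_measurable (PiM T (\<lambda>_. borel))"
  shows "(\<integral>\<^sup>+ \<omega>. F (\<lambda>u\<in>T. X u \<omega>) \<partial>M) = tree_integral \<nu> Q us F (\<lambda>_. undefined)"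
proof -
  let ?P = "PiM T (\<lambda>_. borel :: 'x measure)"
  have \<nu>: "borel_prob \<nu>" using branching by (simp add: branching_markov_process_def)
  have XT: "(\<lambda>\<omega>. \<lambda>u\<in>T. X u \<omega>) \<in> M \<rightarrow>\<^sub>M ?P"
    using T by (intro measurable_restrict) (auto simp: rooted_subtree_def)
  \<comment> \<open>Before any coordinate is bound, the configuration space is the product over the
    empty index set, whose only point is \<open>\<lambda>_. undefined\<close>.\<close>
  have u: "(\<lambda>_. undefined) \<in> space (PiM {} (\<lambda>_::nat list. borel :: 'x measure))"
    by (simp add: space_PiM)
  obtain K where K: "K \<in> PiM {} (\<lambda>_. borel :: 'x measure) \<rightarrow>\<^sub>M subprob_algebra ?P"
    and KF': "\<forall>x\<in>space (PiM {} (\<lambda>_. borel)). \<forall>F\<in>borel_measurable ?P.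
      tree_integral \<nu> Q us F x = (\<integral>\<^sup>+ y. F y \<partial>K x)"
    using tree_integral_kernel[OF kernel \<nu> parents_first_tree_order[OF us(2)]]
    unfolding us(1) Un_empty_left by (elim bexE)
  note KF = bspec[OF bspec[OF KF' u]]
  have sK: "sets (K (\<lambda>_. undefined)) = sets ?P"
    using measurable_space[OF K u] by (simp add: space_subprob_algebra)
  have "distr M ?P (\<lambda>\<omega>. \<lambda>u\<in>T. X u \<omega>) = K (\<lambda>_. undefined)"
  proof (rule measure_eqI)
    fix B assume "B \<in> sets (distr M ?P (\<lambda>\<omega>. \<lambda>u\<in>T. X u \<omega>))"
    then have B: "B \<in> sets ?P" by simp
    have "emeasure (distr M ?P (\<lambda>\<omega>. \<lambda>u\<in>T. X u \<omega>)) B = emeasure M {\<omega>\<in>space M. (\<lambda>u\<in>T. X u \<omega>) \<in> B}"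
      using B by (subst emeasure_distr[OF XT]) (auto intro!: arg_cong[where f = "emeasure M"])
    also have "\<dots> = tree_integral \<nu> Q us (indicator B) (\<lambda>_. undefined)"
      using branching T us B by (simp add: branching_markov_process_def)
    also have "\<dots> = emeasure (K (\<lambda>_. undefined)) B"
      using B by (subst KF) (auto simp: sK)
    finally show "emeasure (distr M ?P (\<lambda>\<omega>. \<lambda>u\<in>T. X u \<omega>)) B = emeasure (K (\<lambda>_. undefined)) B" .
  qed (simp add: sK)
  moreover have "(\<integral>\<^sup>+ x. F x \<partial>distr M ?P (\<lambda>\<omega>. \<lambda>u\<in>T. X u \<omega>)) = (\<integral>\<^sup>+ \<omega>. F (\<lambda>u\<in>T. X u \<omega>) \<partial>M)"
    using F by (intro nn_integral_distr[OF XT]) simp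
  ultimately show ?thesis by (simp add: KF[OF F])
qed

end

section \<open>The Markov property along one edge\<close>

text \<open>Sorting by height works, since a parent is strictly shorter than its child.\<close>

lemma parents_first_exists:
  assumes "finite T" "rooted_subtree T"
  obtains us where "set us = T" "parents_first us"
proof -
  obtain xs where xs: "set xs = T" "distinct xs"
    using finite_distinct_list[OF assms(1)] by blast
  define us where "us = sort_key length xs"
  have us: "set us = T" "distinct us" "sorted (map length us)"
    using xs by (auto simp: us_def)
  have "butlast (us ! i) \<in> set (take i us)" if i: "i < length us" "us ! i \<noteq> []" for i
  proof -
    have "butlast (us ! i) \<in> set us"
      using assms(2) us(1) i nth_mem[OF i(1)] by (auto simp: rooted_subtree_def)
    then obtain j where j: "j < length us" "us ! j = butlast (us ! i)"
      by (auto simp: in_set_conv_nth)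
    have "j < i"
    proof (rule ccontr)
      assume "\<not> j < i"
      then have "length (us ! i) \<le> length (us ! j)"
        using sorted_nth_mono[OF us(3), of i j] i(1) j(1) by simp
      moreover have "length (us ! j) < length (us ! i)" using i(2) by (simp add: j(2))
      ultimately show False by simp
    qed
    then show ?thesis using j i by (metis in_set_conv_nth length_take min_less_iff_conj nth_take)
  qed
  then have "parents_first us" using us by (simp add: parents_first_def)
  then show thesis using that us(1) by blast
qed

lemma UHN_prefix: "prefix u v \<Longrightarrow> v \<in> UHN \<Longrightarrow> u \<in> UHN"
  by (auto simp: UHN_def dest: set_mono_prefix)

lemma parents_first_snoc:
  "parents_first us \<Longrightarrow> u \<notin> set us \<Longrightarrow> butlast u \<in> set us \<Longrightarrow> parents_first (us @ [u])"
  by (auto simp: parents_first_def nth_append less_Suc_eq)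

text \<open>The vertex \<open>u\<close> can be listed last, after a subtree containing
  \<open>v\<close> and \<open>butlast u\<close>. Its variable is then integrated first, against
  \<open>Q (X (butlast u))\<close>, while \<open>X v\<close> stays fixed. The condition on prefixes
  says that \<open>v\<close> is neither \<open>u\<close> nor a descendant of
  \<open>u\<close>.\<close>

lemma (in branching_process) nn_integral_step:
  fixes \<phi> \<psi> :: "'x \<Rightarrow> ennreal"
  assumes u: "u \<in> UHN" "u \<noteq> []" and v: "v \<in> UHN" and uv: "\<not> prefix u v"
    and [measurable]: "\<phi> \<in> borel_measurable borel" "\<psi> \<in> borel_measurable borel"
  shows "(\<integral>\<^sup>+ \<omega>. \<psi> (X v \<omega>) * \<phi> (X u \<omega>) \<partial>M)
       = (\<integral>\<^sup>+ \<omega>. \<psi> (X v \<omega>) * (\<integral>\<^sup>+ y. \<phi> y \<partial>Q (X (butlast u) \<omega>)) \<partial>M)"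
proof -
  \<comment> \<open>The ancestral lines of \<open>v\<close> and of the parent of \<open>u\<close>.
    They avoid \<open>u\<close>, which is no prefix of \<open>v\<close> and is longer than its
    parent, so \<open>u\<close> is a leaf of \<open>insert u T\<close>.\<close>
  define T where "T = set (prefixes v) \<union> set (prefixes (butlast u))"
  have bu: "prefix (butlast u) u" by (metis append_butlast_last_id prefixI u(2))
  have T: "finite T" "v \<in> T" "butlast u \<in> T" "u \<notin> T"
    using uv u by (auto simp: T_def dest!: prefix_length_le) (cases u rule: rev_cases; simp)
  have "prefix (butlast x) y" if "prefix x y" for x y :: "nat list"
    using that by (metis append_butlast_last_id butlast.simps(1) prefixI prefix_order.trans)
  then have rT: "rooted_subtree T"
    using v UHN_prefix[OF bu u(1)] by (auto simp: rooted_subtree_def T_def intro: UHN_prefix)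
  have rT': "rooted_subtree (insert u T)"
    using rT u T(3) by (auto simp: rooted_subtree_def)
  obtain us where us: "set us = T" "parents_first us"
    using parents_first_exists[OF T(1) rT] .
  have us': "set (us @ [u]) = insert u T" "parents_first (us @ [u])"
    using us T by (auto intro: parents_first_snoc)
  have Q'[measurable]: "Q \<in> borel \<rightarrow>\<^sub>M subprob_algebra borel"
    using kernel by (simp add: markov_kernel_def measurable_prob_algebraD)
  have QS: "sets (Q x) = sets borel" for x
    using measurable_space[OF Q', of x] by (simp add: space_subprob_algebra)
  have QM: "(\<lambda>x. \<integral>\<^sup>+ y. \<phi> y \<partial>Q x) \<in> borel_measurable borel"
    by measurable
  have comp: "(\<lambda>x. h (x i)) \<in> borel_measurable (PiM I (\<lambda>_. borel))"
    if "i \<in> I" "h \<in> borel_measurable borel" for h :: "'x \<Rightarrow> ennreal" and I and i :: "nat list"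
    by (rule measurable_compose[OF measurable_component_singleton[OF that(1), of "\<lambda>_. borel"] that(2)])
  have m1: "(\<lambda>x. \<psi> (x v) * \<phi> (x u)) \<in> borel_measurable (PiM (insert u T) (\<lambda>_. borel))"
    by (intro borel_measurable_times_ennreal comp assms insertI1 insertI2 T)
  have m2: "(\<lambda>x. \<psi> (x v) * (\<integral>\<^sup>+ y. \<phi> y \<partial>Q (x (butlast u)))) \<in> borel_measurable (PiM T (\<lambda>_. borel))"
    by (intro borel_measurable_times_ennreal comp[OF _ QM] comp assms T)
  have vu: "v \<noteq> u" using uv by auto
  have "(\<integral>\<^sup>+ \<omega>. \<psi> (X v \<omega>) * \<phi> (X u \<omega>) \<partial>M) =
      tree_integral \<nu> Q (us @ [u]) (\<lambda>x. \<psi> (x v) * \<phi> (x u)) (\<lambda>_. undefined)"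
    using nn_integral_tree[OF _ rT' us' m1] T by simp
  \<comment> \<open>Updating the coordinate \<open>u\<close> leaves those of \<open>v\<close> and
    \<open>butlast u\<close> unchanged, so the factor in \<open>v\<close> comes out of the innermost
    integral.\<close>
  also have "\<dots> = tree_integral \<nu> Q us (\<lambda>x. \<psi> (x v) * (\<integral>\<^sup>+ y. \<phi> y \<partial>Q (x (butlast u)))) (\<lambda>_. undefined)"
    using u vu by (simp add: tree_integral_snoc nn_integral_cmult measurable_cong_sets[OF QS refl])
  also have "\<dots> = (\<integral>\<^sup>+ \<omega>. \<psi> (X v \<omega>) * (\<integral>\<^sup>+ y. \<phi> y \<partial>Q (X (butlast u) \<omega>)) \<partial>M)"
    using nn_integral_tree[OF T(1) rT us m2] T by simp
  finally show ?thesis .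
qed

section \<open>The transition operator on bounded Borel functions\<close>

text \<open>This class replaces the bounded continuous functions because \<open>kernel_op Q\<close>
  maps it to itself, whereas \<open>kernel_op Q f\<close> need not be continuous for continuous
  \<open>f\<close>.\<close>

definition bounded_borel :: "('x::topological_space \<Rightarrow> real) set" where
  "bounded_borel = {f. f \<in> borel_measurable borel \<and> bounded (range f)}"

lemma bounded_borel_measurable [measurable_dest]: "f \<in> bounded_borel \<Longrightarrow> f \<in> borel_measurable borel"
  by (simp add: bounded_borel_def)

lemma bounded_borelI: "f \<in> borel_measurable borel \<Longrightarrow> (\<And>x. \<bar>f x\<bar> \<le> C) \<Longrightarrow> f \<in> bounded_borel"
  by (auto simp: bounded_borel_def bounded_iff)

lemma bounded_borelE:
  assumes "f \<in> bounded_borel"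
  obtains C where "0 \<le> C" "\<And>x. \<bar>f x\<bar> \<le> C"
proof -
  obtain C where C: "\<And>x. \<bar>f x\<bar> \<le> C" using assms by (auto simp: bounded_borel_def bounded_iff)
  have "0 \<le> C" using abs_ge_zero C by (rule order_trans)
  then show thesis using that C by blast
qed

lemma bounded_borel_const: "(\<lambda>_. c) \<in> bounded_borel"
  by (rule bounded_borelI[where C = "\<bar>c\<bar>"]) auto

lemma bounded_borel_add:
  assumes "f \<in> bounded_borel" "g \<in> bounded_borel"
  shows "(\<lambda>x. f x + g x) \<in> bounded_borel"
proof -
  obtain C D where "\<And>x. \<bar>f x\<bar> \<le> C" "\<And>x. \<bar>g x\<bar> \<le> D" using assms by (metis bounded_borelE)
  then have "\<bar>f x + g x\<bar> \<le> C + D" for x by (meson abs_triangle_ineq add_mono order_trans)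
  then show ?thesis using assms by (intro bounded_borelI) (auto simp: bounded_borel_def)
qed

lemma bounded_borel_abs: "f \<in> bounded_borel \<Longrightarrow> (\<lambda>x. \<bar>f x\<bar>) \<in> bounded_borel"
  by (auto simp: bounded_borel_def bounded_iff)

context
  fixes Q :: "'x::metric_space \<Rightarrow> 'x measure"
  assumes Q: "markov_kernel Q"
begin

lemma markov_kernel_measurable: "Q \<in> borel \<rightarrow>\<^sub>M subprob_algebra borel"
  using Q by (simp add: markov_kernel_def measurable_prob_algebraD)

lemma markov_kernel_sets: "sets (Q x) = sets borel"
  using measurable_space[OF markov_kernel_measurable, of x] by (simp add: space_subprob_algebra)

lemma markov_kernel_prob_space: "prob_space (Q x)"
  using Q measurable_space[of Q borel "prob_algebra borel" x]
  by (simp add: markov_kernel_def space_prob_algebra)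

lemma markov_kernel_integrable:
  assumes "f \<in> bounded_borel" shows "integrable (Q x) f"
proof -
  interpret prob_space "Q x" by (rule markov_kernel_prob_space)
  obtain C where "\<And>x. \<bar>f x\<bar> \<le> C" using assms by (metis bounded_borelE)
  then show ?thesis
    using assms by (intro integrable_const_bound[where B = C])
      (auto simp: bounded_borel_def measurable_cong_sets[OF markov_kernel_sets refl])
qed

lemma kernel_op_const: "kernel_op Q (\<lambda>_. c) = (\<lambda>_. c)"
  by (simp add: kernel_op_def prob_space.prob_space[OF markov_kernel_prob_space])

lemma kernel_op_add:
  "f \<in> bounded_borel \<Longrightarrow> g \<in> bounded_borel \<Longrightarrow>
    kernel_op Q (\<lambda>x. f x + g x) = (\<lambda>x. kernel_op Q f x + kernel_op Q g x)"
  by (simp add: kernel_op_def markov_kernel_integrable)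

lemma kernel_op_abs_le:
  assumes f: "f \<in> bounded_borel" and C: "\<And>x. \<bar>f x\<bar> \<le> C"
  shows "\<bar>kernel_op Q f x\<bar> \<le> C"
proof -
  interpret prob_space "Q x" by (rule markov_kernel_prob_space)
  have "\<bar>kernel_op Q f x\<bar> \<le> (\<integral>y. \<bar>f y\<bar> \<partial>Q x)"
    unfolding kernel_op_def by (rule integral_abs_bound)
  also have "\<dots> \<le> C"
    by (rule integral_le_const) (auto simp: C markov_kernel_integrable bounded_borel_abs f)
  finally show ?thesis .
qed

lemma kernel_op_bounded_borel:
  assumes "f \<in> bounded_borel" shows "kernel_op Q f \<in> bounded_borel"
proof -
  obtain C where C: "\<And>x. \<bar>f x\<bar> \<le> C" using assms by (metis bounded_borelE)
  have "kernel_op Q f \<in> borel_measurable borel"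
    unfolding kernel_op_def
    by (rule measurable_compose[OF markov_kernel_measurable integral_measurable_subprob_algebra])
       (rule bounded_borel_measurable[OF assms])
  then show ?thesis by (rule bounded_borelI) (rule kernel_op_abs_le[OF assms C])
qed

lemma kernel_op_pow_bounded_borel:
  "f \<in> bounded_borel \<Longrightarrow> (kernel_op Q ^^ n) f \<in> bounded_borel"
  by (induction n) (simp_all add: kernel_op_bounded_borel)

lemma kernel_op_pow_abs_le:
  assumes f: "f \<in> bounded_borel" and C: "\<And>x. \<bar>f x\<bar> \<le> C"
  shows "\<bar>(kernel_op Q ^^ n) f x\<bar> \<le> C"
  by (induction n arbitrary: x)
     (simp_all add: C kernel_op_abs_le kernel_op_pow_bounded_borel f)

text \<open>A Markov kernel fixes constants, so centring commutes with its powers. This turns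
  ergodicity for \<open>f\<close> into decay to 0 for the centred function.\<close>

lemma kernel_op_pow_diff_const:
  assumes f: "f \<in> bounded_borel"
  shows "(kernel_op Q ^^ n) (\<lambda>x. f x - c) = (\<lambda>x. (kernel_op Q ^^ n) f x - c)"
proof (induction n)
  case (Suc n)
  show ?case
    using kernel_op_add[OF kernel_op_pow_bounded_borel[OF f, of n] bounded_borel_const[of "- c"]]
    by (simp add: Suc.IH kernel_op_const)
qed simp

text \<open>Dominated convergence under \<open>Q x\<close>, once for each application of the kernel.
  The bound \<open>C\<close> survives because \<open>kernel_op Q\<close> is a contraction in the
  supremum norm.\<close>

lemma kernel_op_pow_tendsto_0:
  assumes h: "\<And>m. h m \<in> bounded_borel" and C: "\<And>m x. \<bar>h m x\<bar> \<le> C"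
    and lim: "\<And>x. (\<lambda>m. h m x) \<longlonglongrightarrow> 0"
  shows "(\<lambda>m. (kernel_op Q ^^ j) (h m) x) \<longlonglongrightarrow> 0"
proof (induction j arbitrary: x)
  case (Suc j)
  interpret prob_space "Q x" by (rule markov_kernel_prob_space)
  have "(\<lambda>m. \<integral>y. (kernel_op Q ^^ j) (h m) y \<partial>Q x) \<longlonglongrightarrow> (\<integral>y. 0 \<partial>Q x)"
  proof (rule integral_dominated_convergence[where w = "\<lambda>_. C"])
    show "(kernel_op Q ^^ j) (h m) \<in> borel_measurable (Q x)" for m
      using kernel_op_pow_bounded_borel[OF h, of j m]
      by (simp add: bounded_borel_def measurable_cong_sets[OF markov_kernel_sets refl])
  qed (auto simp: Suc.IH kernel_op_pow_abs_le[OF h C])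
  moreover have "(kernel_op Q ^^ Suc j) (h m) x = (\<integral>y. (kernel_op Q ^^ j) (h m) y \<partial>Q x)" for m
    by (simp only: funpow.simps comp_apply kernel_op_def[of Q "(kernel_op Q ^^ j) (h m)"])
  ultimately show ?case by simp
qed (simp add: lim)

end

section \<open>Expectations at one and at two vertices\<close>

context branching_process
begin

lemma bounded_borel_X_measurable:
  assumes "\<phi> \<in> bounded_borel" "u \<in> UHN"
  shows "(\<lambda>\<omega>. \<phi> (X u \<omega>)) \<in> borel_measurable M"
  by (rule measurable_compose[OF X_measurable[OF assms(2)] bounded_borel_measurable[OF assms(1)]])

lemma integrable_bounded_borel:
  assumes "\<phi> \<in> bounded_borel" "u \<in> UHN"
  shows "integrable M (\<lambda>\<omega>. \<phi> (X u \<omega>))"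
proof -
  obtain C where "\<And>x. \<bar>\<phi> x\<bar> \<le> C" using assms(1) by (metis bounded_borelE)
  then show ?thesis
    using assms by (intro integrable_const_bound[where B = C]) (auto intro: bounded_borel_X_measurable)
qed

lemma integrable_bounded_borel_mult:
  assumes "\<phi> \<in> bounded_borel" "u \<in> UHN" "\<psi> \<in> bounded_borel" "v \<in> UHN"
  shows "integrable M (\<lambda>\<omega>. \<phi> (X u \<omega>) * \<psi> (X v \<omega>))"
proof -
  obtain C D where "0 \<le> C" "\<And>x. \<bar>\<phi> x\<bar> \<le> C" "\<And>x. \<bar>\<psi> x\<bar> \<le> D" using assms by (metis bounded_borelE)
  then have "\<bar>\<phi> x * \<psi> y\<bar> \<le> C * D" for x y by (simp add: abs_mult mult_mono)
  then show ?thesis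
    using assms by (intro integrable_const_bound[where B = "C * D"])
      (auto intro!: borel_measurable_times bounded_borel_X_measurable)
qed

text \<open>Adding constants makes both functions nonnegative, which reduces the claim to
  \<open>nn_integral_step\<close>; linearity then removes the constants again.\<close>

lemma integral_step:
  assumes u: "u \<in> UHN" "u \<noteq> []" and v: "v \<in> UHN" and uv: "\<not> prefix u v"
    and \<phi>: "\<phi> \<in> bounded_borel" and \<psi>: "\<psi> \<in> bounded_borel"
  shows "(\<integral>\<omega>. \<psi> (X v \<omega>) * \<phi> (X u \<omega>) \<partial>M) = (\<integral>\<omega>. \<psi> (X v \<omega>) * kernel_op Q \<phi> (X (butlast u) \<omega>) \<partial>M)"
proof -
  have bu: "butlast u \<in> UHN"
    using u by (metis UHN_prefix append_butlast_last_id prefixI)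
  have nonneg: "(\<integral>\<omega>. \<beta> (X v \<omega>) * \<alpha> (X u \<omega>) \<partial>M) = (\<integral>\<omega>. \<beta> (X v \<omega>) * kernel_op Q \<alpha> (X (butlast u) \<omega>) \<partial>M)"
    if \<alpha>: "\<alpha> \<in> bounded_borel" "\<And>x. 0 \<le> \<alpha> x" and \<beta>: "\<beta> \<in> bounded_borel" "\<And>x. 0 \<le> \<beta> x"
    for \<alpha> \<beta> :: "'x \<Rightarrow> real"
  proof -
    note meas = borel_measurable_times[OF bounded_borel_X_measurable bounded_borel_X_measurable]
    note [measurable] = \<alpha>(1) \<beta>(1)
    have K: "(\<integral>\<^sup>+ y. ennreal (\<alpha> y) \<partial>Q x) = ennreal (kernel_op Q \<alpha> x)" for x
      unfolding kernel_op_def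
      by (rule nn_integral_eq_integral) (auto simp: \<alpha> markov_kernel_integrable[OF kernel])
    have K0: "0 \<le> kernel_op Q \<alpha> x" for x
      by (simp add: kernel_op_def \<alpha>)
    have "(\<integral>\<^sup>+ \<omega>. ennreal (\<beta> (X v \<omega>) * \<alpha> (X u \<omega>)) \<partial>M) =
        (\<integral>\<^sup>+ \<omega>. ennreal (\<beta> (X v \<omega>) * kernel_op Q \<alpha> (X (butlast u) \<omega>)) \<partial>M)"
      using nn_integral_step[OF u v uv, of "\<lambda>x. ennreal (\<alpha> x)" "\<lambda>x. ennreal (\<beta> x)"]
      by (simp add: ennreal_mult \<alpha> \<beta> K K0)
    then show ?thesis
      by (simp add: integral_eq_nn_integral \<alpha> \<beta> K0 meas u v bu kernel_op_bounded_borel[OF kernel])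
  qed
  obtain C where C: "0 \<le> C" "\<And>x. \<bar>\<phi> x\<bar> \<le> C" using \<phi> by (metis bounded_borelE)
  obtain D where D: "0 \<le> D" "\<And>x. \<bar>\<psi> x\<bar> \<le> D" using \<psi> by (metis bounded_borelE)
  define \<alpha> where "\<alpha> = (\<lambda>x. \<phi> x + C)"
  define \<beta> where "\<beta> = (\<lambda>x. \<psi> x + D)"
  have \<alpha>: "\<alpha> \<in> bounded_borel" "\<And>x. 0 \<le> \<alpha> x"
    unfolding \<alpha>_def using C(2) by (auto intro: bounded_borel_add \<phi> bounded_borel_const simp: abs_le_iff) (smt (verit))
  have \<beta>: "\<beta> \<in> bounded_borel" "\<And>x. 0 \<le> \<beta> x"
    unfolding \<beta>_def using D(2) by (auto intro: bounded_borel_add \<psi> bounded_borel_const simp: abs_le_iff) (smt (verit))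
  have Q\<alpha>: "kernel_op Q \<alpha> = (\<lambda>x. kernel_op Q \<phi> x + C)"
    unfolding \<alpha>_def
    by (simp add: kernel_op_add[OF kernel \<phi> bounded_borel_const] kernel_op_const[OF kernel])
  note int = integrable_bounded_borel_mult integrable_bounded_borel u(1) v bu
  \<comment> \<open>The nonnegative case is applied to \<beta> and to the constant \<open>D\<close>;
    the difference of the two identities is the one for \<psi>.\<close>
  have "(\<integral>\<omega>. \<psi> (X v \<omega>) * \<alpha> (X u \<omega>) \<partial>M) = (\<integral>\<omega>. \<psi> (X v \<omega>) * kernel_op Q \<alpha> (X (butlast u) \<omega>) \<partial>M)"
    using nonneg[OF \<alpha> \<beta>] nonneg[OF \<alpha> bounded_borel_const[of D]] D(1)
    by (auto simp: \<beta>_def distrib_right int \<psi> \<alpha> kernel_op_bounded_borel[OF kernel])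
  then show ?thesis
    unfolding Q\<alpha> unfolding \<alpha>_def
    by (simp add: distrib_left int \<phi> \<psi> kernel_op_bounded_borel[OF kernel])
qed

text \<open>Climbs from \<open>w @ s\<close> to \<open>w\<close> edge by edge with
  \<open>X v\<close> fixed, each edge contributing one factor of \<open>Q\<close>. By the prefix
  condition no vertex on the way, \<open>w\<close> excepted, is \<open>v\<close> or an ancestor of
  \<open>v\<close>, so \<open>integral_step\<close> applies to each edge.\<close>

lemma integral_branch:
  assumes "w @ s \<in> UHN" "v \<in> UHN" "\<And>t. t \<noteq> [] \<Longrightarrow> prefix t s \<Longrightarrow> \<not> prefix (w @ t) v"
    and "\<phi> \<in> bounded_borel" "\<psi> \<in> bounded_borel"
  shows "(\<integral>\<omega>. \<psi> (X v \<omega>) * \<phi> (X (w @ s) \<omega>) \<partial>M) =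
    (\<integral>\<omega>. \<psi> (X v \<omega>) * (kernel_op Q ^^ length s) \<phi> (X w \<omega>) \<partial>M)"
  using assms
proof (induction s arbitrary: \<phi> rule: rev_induct)
  case (snoc i s)
  have ws: "w @ s \<in> UHN" by (rule UHN_prefix[OF _ snoc.prems(1)]) simp
  have wsi: "w @ s @ [i] \<in> UHN" using snoc.prems(1) by simp
  have np: "\<not> prefix (w @ s @ [i]) v" by (rule snoc.prems(3)) simp_all
  have "(\<integral>\<omega>. \<psi> (X v \<omega>) * \<phi> (X (w @ s @ [i]) \<omega>) \<partial>M) =
      (\<integral>\<omega>. \<psi> (X v \<omega>) * kernel_op Q \<phi> (X (w @ s) \<omega>) \<partial>M)"
    using integral_step[OF wsi _ snoc.prems(2) np snoc.prems(4,5)] by (simp add: butlast_append)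
  \<comment> \<open>The remaining climb carries \<open>kernel_op Q \<phi>\<close> in place of
    \<phi>, hence the induction over arbitrary \<phi>.\<close>
  also have "\<dots> = (\<integral>\<omega>. \<psi> (X v \<omega>) * (kernel_op Q ^^ length s) (kernel_op Q \<phi>) (X w \<omega>) \<partial>M)"
    by (rule snoc.IH[OF ws snoc.prems(2) snoc.prems(3) kernel_op_bounded_borel[OF kernel snoc.prems(4)]
          snoc.prems(5)]) (simp_all add: prefix_append)
  finally show ?case by (simp add: funpow_swap1)
next
  case Nil
  show ?case by simp
qed

text \<open>The climb to the root with test function 1. Consequently the law of \<open>X w\<close>
  depends on \<open>w\<close> only through its height.\<close>

lemma expectation_height:
  assumes "w \<in> UHN" "\<phi> \<in> bounded_borel"
  shows "(\<integral>\<omega>. \<phi> (X w \<omega>) \<partial>M) = (\<integral>\<omega>. (kernel_op Q ^^ length w) \<phi> (X [] \<omega>) \<partial>M)"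
proof -
  have root: "[] \<in> UHN" by (simp add: UHN_def)
  have "(\<integral>\<omega>. 1 * \<phi> (X ([] @ w) \<omega>) \<partial>M) = (\<integral>\<omega>. 1 * (kernel_op Q ^^ length w) \<phi> (X [] \<omega>) \<partial>M)"
    by (rule integral_branch[OF _ root _ assms(2) bounded_borel_const]) (simp_all add: assms(1))
  then show ?thesis by simp
qed

text \<open>Two climbs to the common ancestor \<open>w\<close>: first from \<open>u\<close>, with
  \<open>X v\<close> fixed, then from \<open>v\<close>, with \<open>X w\<close> fixed.\<close>

lemma expectation_product:
  assumes u: "u \<in> UHN" and v: "v \<in> UHN" and \<phi>: "\<phi> \<in> bounded_borel" and \<psi>: "\<psi> \<in> bounded_borel"
  defines "w \<equiv> longest_common_prefix u v"
  shows "(\<integral>\<omega>. \<phi> (X u \<omega>) * \<psi> (X v \<omega>) \<partial>M) =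
    (\<integral>\<omega>. (kernel_op Q ^^ (length u - length w)) \<phi> (X w \<omega>) *
      (kernel_op Q ^^ (length v - length w)) \<psi> (X w \<omega>) \<partial>M)"
proof -
  obtain s where s: "u = w @ s"
    using longest_common_prefix_prefix1[of u v] unfolding w_def[symmetric] by (rule prefixE)
  obtain t where t: "v = w @ t"
    using longest_common_prefix_prefix2[of u v]
    unfolding w_def[symmetric] by (rule prefixE)
  have w: "w \<in> UHN" using UHN_prefix[OF _ u, of w] by (simp add: s)
  \<comment> \<open>A vertex strictly below \<open>w\<close> on the way to \<open>u\<close> that
    also precedes \<open>v\<close> would be a longer common prefix.\<close>
  have np: "\<not> prefix (w @ r) v" if "r \<noteq> []" "prefix r s" for r
  proof
    assume "prefix (w @ r) v"
    moreover have "prefix (w @ r) u" using that(2) by (simp add: s)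
    ultimately have "prefix (w @ r) w" unfolding w_def by (intro longest_common_prefix_max_prefix)
    then show False using that(1) prefix_length_le by fastforce
  qed
  have np': "\<not> prefix (w @ r) w" if "r \<noteq> []" for r
    using that prefix_length_le by fastforce
  have "(\<integral>\<omega>. \<phi> (X u \<omega>) * \<psi> (X v \<omega>) \<partial>M) = (\<integral>\<omega>. \<psi> (X v \<omega>) * \<phi> (X (w @ s) \<omega>) \<partial>M)"
    by (simp add: s mult.commute)
  also have "\<dots> = (\<integral>\<omega>. \<psi> (X v \<omega>) * (kernel_op Q ^^ length s) \<phi> (X w \<omega>) \<partial>M)"
    by (rule integral_branch[OF u[unfolded s] v np \<phi> \<psi>])
  also have "\<dots> = (\<integral>\<omega>. (kernel_op Q ^^ length s) \<phi> (X w \<omega>) * \<psi> (X (w @ t) \<omega>) \<partial>M)"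
    by (simp add: t mult.commute)
  also have "\<dots> = (\<integral>\<omega>. (kernel_op Q ^^ length s) \<phi> (X w \<omega>) * (kernel_op Q ^^ length t) \<psi> (X w \<omega>) \<partial>M)"
    by (rule integral_branch[OF v[unfolded t] w np' \<psi> kernel_op_pow_bounded_borel[OF kernel \<phi>]])
  finally show ?thesis by (simp add: s t)
qed

text \<open>By \<open>expectation_height\<close> the integral is the mean of
  \<open>\<bar>Q^m g\<bar>\<close> at any vertex of height \<open>j\<close>. Dominated convergence
  is used twice: along the \<open>j\<close> steps of the kernel, then under the law of the
  root.\<close>

lemma expectation_kernel_pow_tendsto_0:
  assumes g: "g \<in> bounded_borel" and lim: "\<And>x. (\<lambda>m. (kernel_op Q ^^ m) g x) \<longlonglongrightarrow> 0"
  shows "(\<lambda>m. \<integral>\<omega>. (kernel_op Q ^^ j) (\<lambda>x. \<bar>(kernel_op Q ^^ m) g x\<bar>) (X [] \<omega>) \<partial>M) \<longlonglongrightarrow> 0"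
proof -
  obtain C where C: "0 \<le> C" "\<And>x. \<bar>g x\<bar> \<le> C" using g by (metis bounded_borelE)
  define h where "h = (\<lambda>m x. \<bar>(kernel_op Q ^^ m) g x\<bar>)"
  have h: "h m \<in> bounded_borel" for m
    unfolding h_def by (intro bounded_borel_abs kernel_op_pow_bounded_borel[OF kernel g])
  have hC: "\<bar>h m x\<bar> \<le> C" for m x
    by (simp add: h_def kernel_op_pow_abs_le[OF kernel g C(2)])
  have hlim: "(\<lambda>m. h m x) \<longlonglongrightarrow> 0" for x
    unfolding h_def by (rule tendsto_rabs_zero[OF lim])
  have root: "[] \<in> UHN" by (simp add: UHN_def)
  have "(\<lambda>m. \<integral>\<omega>. (kernel_op Q ^^ j) (h m) (X [] \<omega>) \<partial>M) \<longlonglongrightarrow> (\<integral>\<omega>. 0 \<partial>M)"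
  proof (rule integral_dominated_convergence[where w = "\<lambda>_. C"])
    show "(\<lambda>\<omega>. (kernel_op Q ^^ j) (h m) (X [] \<omega>)) \<in> borel_measurable M" for m
      by (intro bounded_borel_X_measurable kernel_op_pow_bounded_borel[OF kernel h] root)
  qed (auto simp: kernel_op_pow_abs_le[OF kernel h hC] kernel_op_pow_tendsto_0[OF kernel h hC hlim])
  then show ?thesis by (simp add: h_def)
qed

end

section \<open>Second moment of the centred empirical mean\<close>

text \<open>If the distance exceeds \<open>2 * K\<close>, one of the two branches below the common
  ancestor has length at least \<open>K\<close>. The factor of that branch is at most \<epsilon> in
  mean, and the other is bounded by \<open>C\<close>.\<close>

lemma (in branching_process) covariance_bound:
  assumes u: "u \<in> UHN" and v: "v \<in> UHN" and g: "g \<in> bounded_borel" and C: "\<And>x. \<bar>g x\<bar> \<le> C"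
    and d: "tree_dist u v > 2 * K"
    and decay: "\<And>m. m \<ge> K \<Longrightarrow>
      (\<integral>\<omega>. \<bar>(kernel_op Q ^^ m) g (X (longest_common_prefix u v) \<omega>)\<bar> \<partial>M) \<le> \<epsilon>"
  shows "(\<integral>\<omega>. g (X u \<omega>) * g (X v \<omega>) \<partial>M) \<le> C * \<epsilon>"
proof -
  define w where "w = longest_common_prefix u v"
  define a where "a = length u - length w"
  define b where "b = length v - length w"
  have pw: "prefix w u" "prefix w v"
    by (simp_all add: w_def longest_common_prefix_prefix1 longest_common_prefix_prefix2)
  then have "tree_dist u v = a + b"
    by (auto simp: tree_dist_def a_def b_def w_def[symmetric] dest!: prefix_length_le)
  then have ab: "K \<le> a \<or> K \<le> b" using d by auto
  have w: "w \<in> UHN" using UHN_prefix[OF pw(1) u] .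
  have C0: "0 \<le> C" using abs_ge_zero C by (rule order_trans)
  note bb = kernel_op_pow_bounded_borel[OF kernel g]
  \<comment> \<open>The names \<open>a\<close> and \<open>b\<close> are rebound here, so that the
    estimate can be used with either branch as the long one.\<close>
  have bound: "(\<integral>\<omega>. (kernel_op Q ^^ a) g (X w \<omega>) * (kernel_op Q ^^ b) g (X w \<omega>) \<partial>M) \<le> C * \<epsilon>"
    if "K \<le> a" for a b
  proof -
    have "(\<integral>\<omega>. (kernel_op Q ^^ a) g (X w \<omega>) * (kernel_op Q ^^ b) g (X w \<omega>) \<partial>M)
        \<le> (\<integral>\<omega>. C * \<bar>(kernel_op Q ^^ a) g (X w \<omega>)\<bar> \<partial>M)"
    proof (rule integral_mono)
      fix \<omega>
      have "(kernel_op Q ^^ a) g (X w \<omega>) * (kernel_op Q ^^ b) g (X w \<omega>)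
          \<le> \<bar>(kernel_op Q ^^ a) g (X w \<omega>)\<bar> * \<bar>(kernel_op Q ^^ b) g (X w \<omega>)\<bar>"
        by (metis abs_ge_self abs_mult)
      also have "\<dots> \<le> \<bar>(kernel_op Q ^^ a) g (X w \<omega>)\<bar> * C"
        by (intro mult_left_mono kernel_op_pow_abs_le[OF kernel g C]) simp
      finally show "(kernel_op Q ^^ a) g (X w \<omega>) * (kernel_op Q ^^ b) g (X w \<omega>)
          \<le> C * \<bar>(kernel_op Q ^^ a) g (X w \<omega>)\<bar>" by (simp add: mult.commute)
    qed (intro integrable_mult_right integrable_abs integrable_bounded_borel integrable_bounded_borel_mult bb w)+
    also have "\<dots> = C * (\<integral>\<omega>. \<bar>(kernel_op Q ^^ a) g (X w \<omega>)\<bar> \<partial>M)" by simp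
    also have "\<dots> \<le> C * \<epsilon>"
      using decay[OF that] C0 by (intro mult_left_mono) (simp_all add: w_def)
    finally show ?thesis .
  qed
  have "(\<integral>\<omega>. g (X u \<omega>) * g (X v \<omega>) \<partial>M) =
      (\<integral>\<omega>. (kernel_op Q ^^ a) g (X w \<omega>) * (kernel_op Q ^^ b) g (X w \<omega>) \<partial>M)"
    unfolding a_def b_def w_def by (rule expectation_product[OF u v g g])
  also have "\<dots> \<le> C * \<epsilon>"
    using ab bound[of a b] bound[of b a] by (auto simp: mult.commute)
  finally show ?thesis .
qed

text \<open>The predicate \<open>R\<close> marks exceptional ancestors, at which no decay is
  assumed. Pairs that are close or have an exceptional common ancestor contribute at most
  \<open>C\<^sup>2\<close> each, all others at most \<open>C * \<epsilon>\<close>. With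
  \<open>R\<close> left open, both alternatives of the theorem are covered.\<close>

lemma (in branching_process) second_moment_bound:
  assumes A: "finite A" "A \<noteq> {}" "A \<subseteq> UHN" and g: "g \<in> bounded_borel" and C: "\<And>x. \<bar>g x\<bar> \<le> C"
    and \<epsilon>: "0 \<le> \<epsilon>"
    and decay: "\<And>w m. w \<in> UHN \<Longrightarrow> \<not> R w \<Longrightarrow> m \<ge> K \<Longrightarrow>
      (\<integral>\<omega>. \<bar>(kernel_op Q ^^ m) g (X w \<omega>)\<bar> \<partial>M) \<le> \<epsilon>"
  shows "(\<integral>\<omega>. ((\<Sum>u\<in>A. g (X u \<omega>)) / card A)\<^sup>2 \<partial>M) \<le> C * \<epsilon> +
    C\<^sup>2 * measure_pmf.prob (indep_unif_pair A) {(u, v). tree_dist u v \<le> 2 * K} +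
    C\<^sup>2 * measure_pmf.prob (indep_unif_pair A) {(u, v). R (longest_common_prefix u v)}"
proof -
  let ?d = "\<lambda>u v. of_bool (tree_dist u v \<le> 2 * K) :: real"
  let ?r = "\<lambda>u v. of_bool (R (longest_common_prefix u v)) :: real"
  have C0: "0 \<le> C" using abs_ge_zero C by (rule order_trans)
  have le: "(\<integral>\<omega>. g (X u \<omega>) * g (X v \<omega>) \<partial>M) \<le> C * \<epsilon> + C\<^sup>2 * ?d u v + C\<^sup>2 * ?r u v"
    if uv: "u \<in> UHN" "v \<in> UHN" for u v
  proof (cases "tree_dist u v \<le> 2 * K \<or> R (longest_common_prefix u v)")
    case True
    have "g x * g y \<le> C\<^sup>2" for x y
    proof -
      have "g x * g y \<le> \<bar>g x\<bar> * \<bar>g y\<bar>" by (metis abs_ge_self abs_mult)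
      also have "\<dots> \<le> C * C" by (intro mult_mono C C0) simp
      finally show ?thesis by (simp add: power2_eq_square)
    qed
    then have "(\<integral>\<omega>. g (X u \<omega>) * g (X v \<omega>) \<partial>M) \<le> C\<^sup>2"
      by (intro integral_le_const integrable_bounded_borel_mult g uv) simp
    moreover have "0 \<le> C * \<epsilon>" using C0 \<epsilon> by simp
    \<comment> \<open>At least one of the two indicators equals 1 in this case.\<close>
    moreover have "C\<^sup>2 * 1 \<le> C\<^sup>2 * (?d u v + ?r u v)"
      using True by (intro mult_left_mono) auto
    ultimately show ?thesis by (simp only: distrib_left)
  next
    case False
    have "longest_common_prefix u v \<in> UHN"
      using UHN_prefix[OF longest_common_prefix_prefix1 uv(1)] .
    then show ?thesis
      using covariance_bound[OF uv g C, of K \<epsilon>] decay False by auto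
  qed
  let ?n = "(real (card A))\<^sup>2"
  have n: "?n > 0" using A by (simp add: card_gt_0_iff)
  have AU: "u \<in> UHN" if "u \<in> A" for u using A that by auto
  have "(\<integral>\<omega>. ((\<Sum>u\<in>A. g (X u \<omega>)) / card A)\<^sup>2 \<partial>M) =
      (\<integral>\<omega>. (\<Sum>u\<in>A. \<Sum>v\<in>A. g (X u \<omega>) * g (X v \<omega>)) \<partial>M) / ?n"
    by (simp add: power_divide) (simp add: power2_eq_square sum_product)
  also have "(\<integral>\<omega>. (\<Sum>u\<in>A. \<Sum>v\<in>A. g (X u \<omega>) * g (X v \<omega>)) \<partial>M) =
      (\<Sum>u\<in>A. \<Sum>v\<in>A. \<integral>\<omega>. g (X u \<omega>) * g (X v \<omega>) \<partial>M)"
    by (simp add: integrable_bounded_borel_mult g AU)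
  also have "\<dots> \<le> (\<Sum>u\<in>A. \<Sum>v\<in>A. C * \<epsilon> + C\<^sup>2 * ?d u v + C\<^sup>2 * ?r u v)"
    by (intro sum_mono le AU)
  also have "\<dots> = ?n * (C * \<epsilon>) + C\<^sup>2 * (\<Sum>u\<in>A. \<Sum>v\<in>A. ?d u v) + C\<^sup>2 * (\<Sum>u\<in>A. \<Sum>v\<in>A. ?r u v)"
    by (simp only: sum.distrib sum_distrib_left[symmetric] sum_constant) (simp add: power2_eq_square)
  finally show ?thesis
    using n by (simp add: prob_indep_unif_pair[OF A(1,2)] add_divide_distrib divide_right_mono)
qed

section \<open>Decay in mean under each of the two alternatives\<close>

text \<open>The supremum dominates the integrand at every state, so one \<open>K\<close> serves all
  vertices, whatever the law of \<open>X w\<close>.\<close>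

lemma (in branching_process) decay_uniform:
  assumes g: "g \<in> bounded_borel" and lim: "(\<lambda>n. SUP x. \<bar>(kernel_op Q ^^ n) g x\<bar>) \<longlonglongrightarrow> 0" and \<epsilon>: "0 < \<epsilon>"
  shows "\<exists>K. \<forall>w\<in>UHN. \<forall>m\<ge>K. (\<integral>\<omega>. \<bar>(kernel_op Q ^^ m) g (X w \<omega>)\<bar> \<partial>M) \<le> \<epsilon>"
proof -
  obtain C where C: "\<And>x. \<bar>g x\<bar> \<le> C" using g by (metis bounded_borelE)
  obtain K where K: "\<And>m. m \<ge> K \<Longrightarrow> (SUP x. \<bar>(kernel_op Q ^^ m) g x\<bar>) < \<epsilon>"
    using order_tendstoD(2)[OF lim \<epsilon>] by (auto simp: eventually_sequentially)
  have "\<bar>(kernel_op Q ^^ m) g x\<bar> \<le> \<epsilon>" if "m \<ge> K" for m x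
  proof -
    \<comment> \<open>A real supremum is an upper bound only for a set bounded above; here
      \<open>C\<close> is such a bound.\<close>
    have "\<bar>(kernel_op Q ^^ m) g x\<bar> \<le> (SUP x. \<bar>(kernel_op Q ^^ m) g x\<bar>)"
      by (intro cSUP_upper bdd_aboveI2[where M = C] kernel_op_pow_abs_le[OF kernel g C]) simp
    then show ?thesis using K[OF that] by simp
  qed
  then show ?thesis
    by (intro exI[of _ K] ballI allI impI integral_le_const integrable_abs integrable_bounded_borel
        kernel_op_pow_bounded_borel[OF kernel g]) auto
qed

text \<open>The means depend on \<open>w\<close> only through its height, so heights up to
  \<open>k\<close> give finitely many null sequences, and a common \<open>K\<close> exists.\<close>

lemma (in branching_process) decay_bounded_height:
  assumes g: "g \<in> bounded_borel" and lim: "\<And>x. (\<lambda>n. (kernel_op Q ^^ n) g x) \<longlonglongrightarrow> 0" and \<epsilon>: "0 < \<epsilon>"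
  shows "\<exists>K. \<forall>w\<in>UHN. length w \<le> k \<longrightarrow>
    (\<forall>m\<ge>K. (\<integral>\<omega>. \<bar>(kernel_op Q ^^ m) g (X w \<omega>)\<bar> \<partial>M) \<le> \<epsilon>)"
proof -
  define r where "r = (\<lambda>j m. \<integral>\<omega>. (kernel_op Q ^^ j) (\<lambda>x. \<bar>(kernel_op Q ^^ m) g x\<bar>) (X [] \<omega>) \<partial>M)"
  have "\<forall>\<^sub>F m in sequentially. r j m < \<epsilon>" for j
    unfolding r_def by (rule order_tendstoD(2)[OF expectation_kernel_pow_tendsto_0[OF g lim] \<epsilon>])
  then have "\<forall>\<^sub>F m in sequentially. \<forall>j\<in>{..k}. r j m < \<epsilon>"
    by (intro eventually_ball_finite) auto
  then obtain K where K: "\<And>m j. m \<ge> K \<Longrightarrow> j \<le> k \<Longrightarrow> r j m < \<epsilon>"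
    by (auto simp: eventually_sequentially)
  have "(\<integral>\<omega>. \<bar>(kernel_op Q ^^ m) g (X w \<omega>)\<bar> \<partial>M) = r (length w) m" if "w \<in> UHN" for w m
    unfolding r_def
    by (intro expectation_height that bounded_borel_abs kernel_op_pow_bounded_borel[OF kernel g])
  then show ?thesis using K by (intro exI[of _ K]) (auto intro: less_imp_le)
qed

section \<open>Convergence of the empirical means in mean square\<close>

theorem theorem1p2:
  fixes A :: "nat \<Rightarrow> nat list set"
    and M :: "'w measure"
    and X :: "nat list \<Rightarrow> 'w \<Rightarrow> 'x::metric_space"
    and Q :: "'x \<Rightarrow> 'x measure"
    and \<nu> \<mu> :: "'x measure"
    and f :: "'x \<Rightarrow> real"
  assumes A: "\<And>n. finite (A n)" "\<And>n. A n \<noteq> {}" "\<And>n. A n \<subseteq> UHN"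
    and dist: "\<And>k::nat. (\<lambda>n. measure_pmf.prob (indep_unif_pair (A n))
                 {(u, v). tree_dist u v \<le> k}) \<longlonglongrightarrow> 0"
    and X: "branching_markov_process M Q \<nu> X"
    and Q: "ergodic Q" "invariant_measure Q \<mu>"
    and ab: "uniformly_ergodic Q \<or>
      (\<forall>\<epsilon>>0. \<exists>k::nat. \<forall>\<^sub>F n in sequentially.
         measure_pmf.prob (indep_unif_pair (A n))
           {(u, v). length (longest_common_prefix u v) > k} < \<epsilon>)"
    and f: "continuous_on UNIV f" "bounded (range f)"
  shows "tendsto_L2 M (\<lambda>n. empirical_mean (A n) X f) (\<lambda>_. \<integral>x. f x \<partial>\<mu>)"
proof -
  interpret branching_process M Q \<nu> X by unfold_locales (rule X)
  define c where "c = (\<integral>x. f x \<partial>\<mu>)"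
  define g where "g = (\<lambda>x. f x - c)"
  have fb: "f \<in> bounded_borel"
    using f by (simp add: bounded_borel_def borel_measurable_continuous_onI)
  have gb: "g \<in> bounded_borel"
    using bounded_borel_add[OF fb bounded_borel_const[of "- c"]] by (simp add: g_def)
  have pow: "(kernel_op Q ^^ n) g x = (kernel_op Q ^^ n) f x - c" for n x
    unfolding g_def by (simp add: kernel_op_pow_diff_const[OF kernel fb])
  have lim: "(\<lambda>n. (kernel_op Q ^^ n) g x) \<longlonglongrightarrow> 0" for x
  proof -
    \<comment> \<open>Uniqueness of the invariant measure identifies the limit measure in
      \<open>ergodic\<close> with \<mu>.\<close>
    have "(\<lambda>n. \<bar>(kernel_op Q ^^ n) f x - (\<integral>x. f x \<partial>\<mu>)\<bar>) \<longlonglongrightarrow> 0"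
      using Q f unfolding ergodic_def by metis
    then show ?thesis unfolding pow c_def by (rule tendsto_rabs_zero_cancel)
  qed
  obtain C where C: "0 \<le> C" "\<And>x. \<bar>g x\<bar> \<le> C" using gb by (metis bounded_borelE)
  \<comment> \<open>Both alternatives are brought to one form: no ancestor is exceptional under
    uniform ergodicity, and those of height above \<open>k\<close> are exceptional under
    tightness.\<close>
  have decay: "\<exists>R K. (\<forall>w\<in>UHN. \<not> R w \<longrightarrow> (\<forall>m\<ge>K. (\<integral>\<omega>. \<bar>(kernel_op Q ^^ m) g (X w \<omega>)\<bar> \<partial>M) \<le> \<epsilon>)) \<and>
      (\<forall>\<^sub>F n in sequentially. measure_pmf.prob (indep_unif_pair (A n))
        {(u, v). R (longest_common_prefix u v)} < \<epsilon>)" if \<epsilon>: "0 < \<epsilon>" for \<epsilon>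
    using ab
  proof
    assume "uniformly_ergodic Q"
    then have "(\<lambda>n. SUP x. \<bar>(kernel_op Q ^^ n) f x - (\<integral>x. f x \<partial>\<mu>)\<bar>) \<longlonglongrightarrow> 0"
      using Q f unfolding uniformly_ergodic_def by metis
    then have "(\<lambda>n. SUP x. \<bar>(kernel_op Q ^^ n) g x\<bar>) \<longlonglongrightarrow> 0"
      by (simp add: pow c_def)
    from decay_uniform[OF gb this \<epsilon>] show ?thesis
      using \<epsilon> by (intro exI[of _ "\<lambda>_. False"]) simp
  next
    assume "\<forall>\<epsilon>>0. \<exists>k::nat. \<forall>\<^sub>F n in sequentially. measure_pmf.prob (indep_unif_pair (A n))
           {(u, v). length (longest_common_prefix u v) > k} < \<epsilon>"
    then obtain k where "\<forall>\<^sub>F n in sequentially. measure_pmf.prob (indep_unif_pair (A n))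
           {(u, v). length (longest_common_prefix u v) > k} < \<epsilon>"
      using \<epsilon> by blast
    with decay_bounded_height[OF gb lim \<epsilon>, of k] show ?thesis
      by (intro exI[of _ "\<lambda>w. length w > k"]) (simp add: not_less)
  qed
  let ?E = "\<lambda>n. \<integral>\<omega>. ((\<Sum>u\<in>A n. g (X u \<omega>)) / card (A n))\<^sup>2 \<partial>M"
  have E: "?E \<longlonglongrightarrow> 0"
  proof (rule order_tendstoI)
    fix e :: real assume "e < 0"
    then have "e < ?E n" for n by (rule less_le_trans) simp
    then show "\<forall>\<^sub>F n in sequentially. e < ?E n" by simp
  next
    fix e :: real assume e: "0 < e"
    \<comment> \<open>The three error terms will be at most \<open>C * \<epsilon>\<close>,
      \<open>C\<^sup>2 * \<epsilon>\<close> and \<open>C\<^sup>2 * \<epsilon>\<close>; the added 1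
      makes \<open>D\<close> positive and the final inequality strict.\<close>
    define D where "D = C + C\<^sup>2 + C\<^sup>2 + 1"
    have D: "D > 0" using C(1) by (simp add: D_def add_nonneg_pos)
    define \<epsilon> where "\<epsilon> = e / D"
    have \<epsilon>: "\<epsilon> > 0" using e D by (simp add: \<epsilon>_def)
    obtain R K where RK: "\<And>w m. w \<in> UHN \<Longrightarrow> \<not> R w \<Longrightarrow> m \<ge> K \<Longrightarrow>
        (\<integral>\<omega>. \<bar>(kernel_op Q ^^ m) g (X w \<omega>)\<bar> \<partial>M) \<le> \<epsilon>"
      and R: "\<forall>\<^sub>F n in sequentially. measure_pmf.prob (indep_unif_pair (A n))
        {(u, v). R (longest_common_prefix u v)} < \<epsilon>"
      using decay[OF \<epsilon>] by blast
    show "\<forall>\<^sub>F n in sequentially. ?E n < e"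
      using R order_tendstoD(2)[OF dist[of "2 * K"] \<epsilon>]
    proof eventually_elim
      case (elim n)
      have "?E n \<le> C * \<epsilon> + C\<^sup>2 * measure_pmf.prob (indep_unif_pair (A n)) {(u, v). tree_dist u v \<le> 2 * K} +
          C\<^sup>2 * measure_pmf.prob (indep_unif_pair (A n)) {(u, v). R (longest_common_prefix u v)}"
        by (rule second_moment_bound[OF A gb C(2) less_imp_le[OF \<epsilon>] RK])
      also have "\<dots> \<le> C * \<epsilon> + C\<^sup>2 * \<epsilon> + C\<^sup>2 * \<epsilon>"
        using elim C(1) by (intro add_mono mult_left_mono) auto
      also have "\<dots> < D * \<epsilon>" using \<epsilon> by (simp add: D_def algebra_simps)
      also have "\<dots> = e" using D by (simp add: \<epsilon>_def)
      finally show ?case .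
    qed
  qed
  \<comment> \<open>Since \<open>A n\<close> is finite and non-empty, the average of the constant
    \<open>c\<close> over it is \<open>c\<close>.\<close>
  have mean: "empirical_mean (A n) X f \<omega> - c = (\<Sum>u\<in>A n. g (X u \<omega>)) / card (A n)" for n \<omega>
    using A[of n] by (simp add: empirical_mean_def g_def sum_subtractf field_simps)
  have AU: "u \<in> UHN" if "u \<in> A n" for n u using A that by auto
  have "integrable M (\<lambda>\<omega>. (empirical_mean (A n) X f \<omega>)\<^sup>2)" for n
  proof -
    \<comment> \<open>Expanding the square leaves a finite sum of products of bounded functions,
      each of them integrable.\<close>
    have "(empirical_mean (A n) X f \<omega>)\<^sup>2 =
        (\<Sum>u\<in>A n. \<Sum>v\<in>A n. f (X u \<omega>) * f (X v \<omega>)) / (real (card (A n)))\<^sup>2" for \<omega>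
      by (simp add: empirical_mean_def power_divide) (simp add: power2_eq_square sum_product)
    then show ?thesis by (simp add: integrable_bounded_borel_mult fb AU)
  qed
  moreover have "empirical_mean (A n) X f \<in> borel_measurable M" for n
    unfolding empirical_mean_def
    by (intro borel_measurable_divide borel_measurable_sum borel_measurable_const)
       (auto intro: bounded_borel_X_measurable[OF fb] AU)
  ultimately show ?thesis
    using E by (simp add: tendsto_L2_def mean c_def[symmetric])
qed

end
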